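(* Let $K$ be an ordered field. The theory $T_{\mathrm{ovs}}^d$ of dense pairs of ordered vector spaces over $K$ has the VC 2 property; that is, in every model $(V,W)$ of $T_{\mathrm{ovs}}^d$, every finite set $\Delta(x;y)$ of partitioned $L_{\mathrm{ovs}}^d$-formulas with a single object variable $x$ has uniform definability of types over finite sets with $2$ parameters.
   Context: **Languages and theory.** Let $L_{\mathrm{ovs}}=\{+,-,0,1,<\}\cup\{\ell_\lambda:\lambda\in K\}$, where each $\ell_\lambda$ is a unary function symbol interpreted as scalar multiplication by $\lambda$. Let $T_{\mathrm{ovs}}$ be the $L_{\mathrm{ovs}}$-theory of ordered vector spaces over $K$ with a distinguished positive element $1$. Let $L_{\mathrm{ovs}}^d=L_{\mathrm{ovs}}\cup\{U\}$ with $U$ a unary relation symbol. A dense pair $(V,W)$ of ordered vector spaces over $K$ is an $L_{\mathrm{ovs}}^d$-structure where $V\models T_{\mathrm{ovs}}$ and $U$ is interpreted as a proper $K$-linear subspace $W$ of $V$ containing $1$ that is dense in $V$ (for all $a<b$ in $V$ there is $w\in W$ with $a<w<b$); then $W$ is an elementary substructure of $V$. $T_{\mathrm{ovs}}^d$ is the $L_{\mathrm{ovs}}^d$-theory of dense pairs of ordered vector spaces over $K$. **Partitioned formulas.** A partitioned formula $\phi(x;y)$ is a first-order formula (without parameters) whose free variables are split into object variables $x$ and parameter variables $y$. **$\Delta$-types.** Let $\mathcal M$ be a structure with universe $M$, let $\Delta(x;y)$ be a finite set of partitioned formulas, and let $n=|y|$. For $B\subseteq M^n$, a $\Delta$-type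 over $B$ is a set of formulas, each of the form $\phi(x;b)$ or $\neg\phi(x;b)$ with $\phi\in\Delta$ and $b\in B$, that is maximal among such sets that are consistent (with the theory of $\mathcal M$ with parameters named). $S^\Delta(B)$ denotes the set of $\Delta$-types over $B$. **UDTFS with $d$ parameters.** $\Delta(x;y)$ has uniform definability of types over finite sets with $d$ parameters in $\mathcal M$ if there are finitely many families of formulas $(\phi^1(y;y_1,\dots,y_d))_{\phi\in\Delta},\dots,(\phi^r(y;y_1,\dots,y_d))_{\phi\in\Delta}$ (without parameters, each $y_j$ a tuple of length $n$) such that for every finite nonempty $B\subseteq M^n$ and every $p\in S^\Delta(B)$ there are $i\in\{1,\dots,r\}$ and $b_1,\dots,b_d\in B$ such that for every $b\in B$ and every $\phi\in\Delta$: $\phi(x;b)\in p$ if and only if $\mathcal M\models\phi^i(b;b_1,\dots,b_d)$. A structure has the VC $d$ property if every finite set of partitioned formulas with a single object variable has UDTFS with $d$ parameters. *)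

theory Defs
  imports Complex_Main
begin

section \<open>First-order logic of the language of pairs of ordered vector spaces over K\<close>

text \<open>
  The scalar field \<open>K\<close> is the type \<open>'k\<close>. The connectives and quantifiers that are not listed
  are the usual abbreviations. Variables are named by natural numbers; \<open>Minus\<close> is unary.
\<close>

datatype 'k trm =
    Var nat
  | Zero
  | One
  | Add "'k trm" "'k trm"
  | Minus "'k trm"
  | Scal 'k "'k trm"

datatype 'k fm =
    Eq "'k trm" "'k trm"
  | Less "'k trm" "'k trm"
  | InU "'k trm"
  | Neg "'k fm"
  | And "'k fm" "'k fm"
  | Ex nat "'k fm"

primrec trm_vars :: "'k trm \<Rightarrow> nat set" where
  "trm_vars (Var i) = {i}"
| "trm_vars Zero = {}"
| "trm_vars One = {}"
| "trm_vars (Add s t) = trm_vars s \<union> trm_vars t"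
| "trm_vars (Minus t) = trm_vars t"
| "trm_vars (Scal c t) = trm_vars t"

primrec free_vars :: "'k fm \<Rightarrow> nat set" where
  "free_vars (Eq s t) = trm_vars s \<union> trm_vars t"
| "free_vars (Less s t) = trm_vars s \<union> trm_vars t"
| "free_vars (InU t) = trm_vars t"
| "free_vars (Neg \<phi>) = free_vars \<phi>"
| "free_vars (And \<phi> \<psi>) = free_vars \<phi> \<union> free_vars \<psi>"
| "free_vars (Ex i \<phi>) = free_vars \<phi> - {i}"

text \<open>
  The universe of a structure is the whole type \<open>'v\<close>; the symbols \<open>+\<close>, \<open>-\<close>, \<open>0\<close>, \<open><\<close> are
  interpreted by the type class operations of \<open>'v\<close>, the remaining symbols by the record fields.
\<close>

record ('k, 'v) pair_structure =
  scal_op :: "'k \<Rightarrow> 'v \<Rightarrow> 'v"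
  dist_one :: 'v
  subsp :: "'v set"

primrec trm_val ::
    "('k, 'v::linordered_ab_group_add) pair_structure \<Rightarrow> (nat \<Rightarrow> 'v) \<Rightarrow> 'k trm \<Rightarrow> 'v" where
  "trm_val M e (Var i) = e i"
| "trm_val M e Zero = 0"
| "trm_val M e One = dist_one M"
| "trm_val M e (Add s t) = trm_val M e s + trm_val M e t"
| "trm_val M e (Minus t) = - trm_val M e t"
| "trm_val M e (Scal c t) = scal_op M c (trm_val M e t)"

primrec sat ::
    "('k, 'v::linordered_ab_group_add) pair_structure \<Rightarrow> (nat \<Rightarrow> 'v) \<Rightarrow> 'k fm \<Rightarrow> bool" where
  "sat M e (Eq s t) \<longleftrightarrow> trm_val M e s = trm_val M e t"
| "sat M e (Less s t) \<longleftrightarrow> trm_val M e s < trm_val M e t"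
| "sat M e (InU t) \<longleftrightarrow> trm_val M e t \<in> subsp M"
| "sat M e (Neg \<phi>) \<longleftrightarrow> \<not> sat M e \<phi>"
| "sat M e (And \<phi> \<psi>) \<longleftrightarrow> sat M e \<phi> \<and> sat M e \<psi>"
| "sat M e (Ex i \<phi>) \<longleftrightarrow> (\<exists>a. sat M (e(i := a)) \<phi>)"


section \<open>Dense pairs\<close>

definition ordered_vs ::
    "('k::linordered_field, 'v::linordered_ab_group_add) pair_structure \<Rightarrow> bool" where
  "ordered_vs M \<longleftrightarrow>
     vector_space (scal_op M) \<and>
     (\<forall>c v. 0 < c \<longrightarrow> 0 < v \<longrightarrow> 0 < scal_op M c v) \<and>
     0 < dist_one M"

text \<open>
  All conditions are first-order, so that the models of the theory of dense pairs are exactly the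
  dense pairs.
\<close>

definition dense_pair ::
    "('k::linordered_field, 'v::linordered_ab_group_add) pair_structure \<Rightarrow> bool" where
  "dense_pair M \<longleftrightarrow>
     ordered_vs M \<and>
     module.subspace (scal_op M) (subsp M) \<and>
     subsp M \<noteq> UNIV \<and>
     dist_one M \<in> subsp M \<and>
     (\<forall>a b. a < b \<longrightarrow> (\<exists>w\<in>subsp M. a < w \<and> w < b))"


section \<open>Types over finite sets of formulas\<close>

text \<open>
  In a partitioned formula with \<open>m\<close> object and \<open>n\<close> parameter variables, the object variables are
  \<open>0, \<dots>, m - 1\<close> and the parameter variables are \<open>m, \<dots>, m + n - 1\<close>. Tuples are lists, and a list
  \<open>l\<close> is used as the assignment \<open>(!) l\<close>, whose values outside the free variables are irrelevant.
\<close>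

definition partitioned :: "nat \<Rightarrow> nat \<Rightarrow> 'k fm \<Rightarrow> bool" where
  "partitioned m n \<phi> \<longleftrightarrow> free_vars \<phi> \<subseteq> {..<m + n}"

text \<open>\<open>PosInst \<phi> b\<close> stands for \<open>\<phi>(x; b)\<close> and \<open>NegInst \<phi> b\<close> for \<open>\<not> \<phi>(x; b)\<close>.\<close>

datatype ('k, 'v) inst = PosInst "'k fm" "'v list" | NegInst "'k fm" "'v list"

definition instances :: "'k fm set \<Rightarrow> 'v list set \<Rightarrow> ('k, 'v) inst set" where
  "instances \<Delta> B = {PosInst \<phi> b | \<phi> b. \<phi> \<in> \<Delta> \<and> b \<in> B} \<union> {NegInst \<phi> b | \<phi> b. \<phi> \<in> \<Delta> \<and> b \<in> B}"

primrec realizes ::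
    "('k, 'v::linordered_ab_group_add) pair_structure \<Rightarrow> 'v list \<Rightarrow> ('k, 'v) inst \<Rightarrow> bool" where
  "realizes M a (PosInst \<phi> b) \<longleftrightarrow> sat M ((!) (a @ b)) \<phi>"
| "realizes M a (NegInst \<phi> b) \<longleftrightarrow> \<not> sat M ((!) (a @ b)) \<phi>"

text \<open>
  The theory of \<open>M\<close> with all elements named is complete and deductions are finite. Hence a set of
  formulas with parameters is consistent with this theory iff none of its finite subsets is refuted
  by it, that is, iff each finite subset has a realization in \<open>M\<close>.
\<close>

definition consistent ::
    "('k, 'v::linordered_ab_group_add) pair_structure \<Rightarrow> nat \<Rightarrow> ('k, 'v) inst set \<Rightarrow> bool" where
  "consistent M m p \<longleftrightarrow>
     (\<forall>q. q \<subseteq> p \<longrightarrow> finite q \<longrightarrow> (\<exists>a. length a = m \<and> (\<forall>f\<in>q. realizes M a f)))"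

definition delta_types ::
    "('k, 'v::linordered_ab_group_add) pair_structure \<Rightarrow> nat \<Rightarrow> 'k fm set \<Rightarrow> 'v list set
       \<Rightarrow> ('k, 'v) inst set set" where
  "delta_types M m \<Delta> B =
     {p. p \<subseteq> instances \<Delta> B \<and> consistent M m p \<and>
         (\<forall>q. p \<subseteq> q \<and> q \<subseteq> instances \<Delta> B \<and> consistent M m q \<longrightarrow> q = p)}"


section \<open>Uniform definability of types over finite sets\<close>

text \<open>
  \<open>\<Psi> i \<phi>\<close> is the formula \<open>\<phi>\<^sup>i(y; y\<^sub>1, \<dots>, y\<^sub>d)\<close>; its variables \<open>j * n, \<dots>, j * n + n - 1\<close> form the block
  \<open>y\<close> for \<open>j = 0\<close> and the block \<open>y\<^sub>j\<close> for \<open>j \<ge> 1\<close>.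
\<close>

definition udtfs ::
    "('k, 'v::linordered_ab_group_add) pair_structure \<Rightarrow> nat \<Rightarrow> nat \<Rightarrow> nat \<Rightarrow> 'k fm set \<Rightarrow> bool" where
  "udtfs M d m n \<Delta> \<longleftrightarrow>
     (\<exists>r (\<Psi> :: nat \<Rightarrow> 'k fm \<Rightarrow> 'k fm).
        (\<forall>i<r. \<forall>\<phi>\<in>\<Delta>. free_vars (\<Psi> i \<phi>) \<subseteq> {..<n + d * n}) \<and>
        (\<forall>B p. finite B \<longrightarrow> B \<noteq> {} \<longrightarrow> B \<subseteq> {b. length b = n} \<longrightarrow> p \<in> delta_types M m \<Delta> B \<longrightarrow>
           (\<exists>i<r. \<exists>bs. length bs = d \<and> set bs \<subseteq> B \<and>
              (\<forall>b\<in>B. \<forall>\<phi>\<in>\<Delta>. PosInst \<phi> b \<in> p \<longleftrightarrow> sat M ((!) (b @ concat bs)) (\<Psi> i \<phi>)))))"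

definition vc_property ::
    "('k, 'v::linordered_ab_group_add) pair_structure \<Rightarrow> nat \<Rightarrow> bool" where
  "vc_property M d \<longleftrightarrow>
     (\<forall>n \<Delta>. finite \<Delta> \<longrightarrow> (\<forall>\<phi>\<in>\<Delta>. partitioned 1 n \<phi>) \<longrightarrow> udtfs M d 1 n \<Delta>)"

end

(*
  Let W be the dense subspace of V. Relative to finitely many elements c of V, an element a of V that
  is not among them is described by its cut, given by the largest c below a (or none), and by its
  coset modulo W, given by some c with a - c in W (or none). Every such description with c's from
  the given set is realized, because cosets of W are dense and V / W is infinite. Substituting
  descriptions whose entries are the roots in x of the atomic formulas for the variable x eliminates
  the quantifier in "exists x". In the resulting quantifier-free formulas, the type of a over B is
  again given by such a description, whose two entries come from at most two elements of B.
*)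

theory Submission
  imports Defs
begin

section \<open>Quantifier-free formulas and substitution\<close>

primrec qf :: "'k fm \<Rightarrow> bool" where
  "qf (Eq s t) \<longleftrightarrow> True"
| "qf (Less s t) \<longleftrightarrow> True"
| "qf (InU t) \<longleftrightarrow> True"
| "qf (Neg \<phi>) \<longleftrightarrow> qf \<phi>"
| "qf (And \<phi> \<psi>) \<longleftrightarrow> qf \<phi> \<and> qf \<psi>"
| "qf (Ex i \<phi>) \<longleftrightarrow> False"

primrec tsub :: "(nat \<Rightarrow> 'k trm) \<Rightarrow> 'k trm \<Rightarrow> 'k trm" where
  "tsub \<sigma> (Var i) = \<sigma> i"
| "tsub \<sigma> Zero = Zero"
| "tsub \<sigma> One = One"
| "tsub \<sigma> (Add s t) = Add (tsub \<sigma> s) (tsub \<sigma> t)"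
| "tsub \<sigma> (Minus t) = Minus (tsub \<sigma> t)"
| "tsub \<sigma> (Scal c t) = Scal c (tsub \<sigma> t)"

text \<open>Only meant for quantifier-free formulas; variable capture is not avoided.\<close>

primrec fsub :: "(nat \<Rightarrow> 'k trm) \<Rightarrow> 'k fm \<Rightarrow> 'k fm" where
  "fsub \<sigma> (Eq s t) = Eq (tsub \<sigma> s) (tsub \<sigma> t)"
| "fsub \<sigma> (Less s t) = Less (tsub \<sigma> s) (tsub \<sigma> t)"
| "fsub \<sigma> (InU t) = InU (tsub \<sigma> t)"
| "fsub \<sigma> (Neg \<phi>) = Neg (fsub \<sigma> \<phi>)"
| "fsub \<sigma> (And \<phi> \<psi>) = And (fsub \<sigma> \<phi>) (fsub \<sigma> \<psi>)"
| "fsub \<sigma> (Ex i \<phi>) = Ex i (fsub \<sigma> \<phi>)"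

lemma trm_val_tsub: "trm_val M e (tsub \<sigma> t) = trm_val M (\<lambda>i. trm_val M e (\<sigma> i)) t"
  by (induction t) auto

lemma trm_vars_tsub: "trm_vars (tsub \<sigma> t) = (\<Union>i\<in>trm_vars t. trm_vars (\<sigma> i))"
  by (induction t) auto

lemma sat_fsub: "qf \<phi> \<Longrightarrow> sat M e (fsub \<sigma> \<phi>) \<longleftrightarrow> sat M (\<lambda>i. trm_val M e (\<sigma> i)) \<phi>"
  by (induction \<phi>) (auto simp: trm_val_tsub)

lemma free_vars_fsub: "qf \<phi> \<Longrightarrow> free_vars (fsub \<sigma> \<phi>) = (\<Union>i\<in>free_vars \<phi>. trm_vars (\<sigma> i))"
  by (induction \<phi>) (auto simp: trm_vars_tsub)

lemma qf_fsub: "qf \<phi> \<Longrightarrow> qf (fsub \<sigma> \<phi>)"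
  by (induction \<phi>) auto

lemma trm_val_cong: "(\<And>i. i \<in> trm_vars t \<Longrightarrow> e i = e' i) \<Longrightarrow> trm_val M e t = trm_val M e' t"
  by (induction t) auto

lemma sat_cong: "(\<And>i. i \<in> free_vars \<phi> \<Longrightarrow> e i = e' i) \<Longrightarrow> sat M e \<phi> \<longleftrightarrow> sat M e' \<phi>"
proof (induction \<phi> arbitrary: e e')
  case (Eq s t)
  then show ?case using trm_val_cong[of s e e'] trm_val_cong[of t e e'] by auto
next
  case (Less s t)
  then show ?case using trm_val_cong[of s e e'] trm_val_cong[of t e e'] by auto
next
  case (InU t)
  then show ?case using trm_val_cong[of t e e'] by auto
next
  case (Neg \<phi>)
  then show ?case by (metis free_vars.simps(4) sat.simps(4))
next
  case (And \<phi> \<psi>)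
  then show ?case by (metis UnCI free_vars.simps(5) sat.simps(5))
next
  case (Ex i \<phi>)
  have "sat M (e(i := a)) \<phi> \<longleftrightarrow> sat M (e'(i := a)) \<phi>" for a
    using Ex.prems by (intro Ex.IH) auto
  then show ?case by simp
qed

lemma finite_disjunction:
  assumes "finite S" "\<forall>\<phi>\<in>S. qf \<phi>"
  shows "\<exists>\<psi>. qf \<psi> \<and> free_vars \<psi> = \<Union> (free_vars ` S) \<and> (\<forall>e. sat M e \<psi> \<longleftrightarrow> (\<exists>\<phi>\<in>S. sat M e \<phi>))"
  using assms
proof (induction S)
  case empty
  \<comment> \<open>The empty disjunction is false, hence the sentence \<open>0 < 0\<close>.\<close>
  show ?case by (rule exI[of _ "Less Zero Zero"]) simp
next
  case (insert \<phi> S)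
  then obtain \<psi> where
    "qf \<psi>" "free_vars \<psi> = \<Union> (free_vars ` S)" "\<forall>e. sat M e \<psi> \<longleftrightarrow> (\<exists>\<phi>\<in>S. sat M e \<phi>)"
    by auto
  with insert.prems show ?case
    by (intro exI[of _ "Neg (And (Neg \<phi>) (Neg \<psi>))"]) auto
qed


section \<open>Virtual points\<close>

text \<open>
  \<open>Cut l w\<close> describes an element immediately to the right of \<open>l\<close> (far to the left for \<open>None\<close>) in
  the coset of \<open>w\<close> (in a new coset for \<open>None\<close>).
\<close>

datatype ('a, 'b) point = Exact 'a | Cut "'a option" "'b option"

definition options :: "'a set \<Rightarrow> 'a option set" where
  "options A = insert None (Some ` A)"

definition points :: "'a set \<Rightarrow> ('a, 'a) point set" where
  "points A = Exact ` A \<union> (\<Union>l\<in>options A. Cut l ` options A)"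

lemma finite_points: "finite A \<Longrightarrow> finite (points A)"
  by (simp add: points_def options_def)

lemma options_image: "options (f ` A) = map_option f ` options A"
  by (simp add: options_def image_image)

lemma points_image: "points (f ` A) = map_point f f ` points A"
  by (simp add: points_def options_image image_Un image_UN image_image)

lemma options_family:
  assumes "k \<in> options ((\<lambda>(r, b). f b r) ` (R \<times> B))" "B \<noteq> {}"
  shows "\<exists>b\<in>B. \<exists>l\<in>options R. k = map_option (f b) l"
proof (cases k)
  case None
  then show ?thesis using assms(2) by (auto simp: options_def)
next
  case (Some c)
  then obtain r b where "r \<in> R" "b \<in> B" "c = f b r"
    using assms(1) by (auto simp: options_def)
  then show ?thesis
    using Some by (intro bexI[of _ b] bexI[of _ "Some r"]) (auto simp: options_def)
qed

text \<open>The cut entry and the coset entry may come from different tuples of \<open>B\<close>.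
  This is the source of the two parameters, and the reason why \<open>point\<close> has two type
  arguments, which can be mapped separately. A missing entry involves no tuple; any element of the
  nonempty \<open>B\<close> then serves.\<close>

lemma points_family:
  assumes "p \<in> points ((\<lambda>(r, b). f b r) ` (R \<times> B))" "B \<noteq> {}"
  shows "\<exists>b1\<in>B. \<exists>b2\<in>B. \<exists>q\<in>points R. p = map_point (f b1) (f b2) q"
proof (cases p)
  case (Exact c)
  then obtain r b where "r \<in> R" "b \<in> B" "p = Exact (f b r)"
    using assms(1) by (auto simp: points_def)
  then show ?thesis
    by (intro bexI[of _ b] bexI[of _ "Exact r"]) (auto simp: points_def)
next
  case (Cut l w)
  then have lw: "l \<in> options ((\<lambda>(r, b). f b r) ` (R \<times> B))"
    "w \<in> options ((\<lambda>(r, b). f b r) ` (R \<times> B))"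
    using assms(1) by (auto simp: points_def)
  obtain b1 l' where 1: "b1 \<in> B" "l' \<in> options R" "l = map_option (f b1) l'"
    using options_family[OF lw(1) assms(2)] by blast
  obtain b2 w' where 2: "b2 \<in> B" "w' \<in> options R" "w = map_option (f b2) w'"
    using options_family[OF lw(2) assms(2)] by blast
  have "Cut l' w' \<in> points R"
    using 1 2 by (auto simp: points_def)
  then show ?thesis
    using 1 2 Cut by (intro bexI[of _ b1] bexI[of _ b2] bexI[of _ "Cut l' w'"]) auto
qed

text \<open>The \<open>Cut\<close> clause lists the facts about \<open>a\<close> on which atomic
  formulas with roots in \<open>C\<close> depend. If \<open>l = Some b\<close> with \<open>b\<close>
  in \<open>C\<close>, its instance \<open>c = b\<close> yields \<open>b < a\<close>.\<close>

primrec at_point ::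
    "'v::linordered_ab_group_add set \<Rightarrow> 'v set \<Rightarrow> 'v \<Rightarrow> ('v, 'v) point \<Rightarrow> bool" where
  "at_point W C a (Exact c) \<longleftrightarrow> a = c"
| "at_point W C a (Cut l w) \<longleftrightarrow>
     (\<forall>c\<in>C. a \<noteq> c \<and>
        (a < c \<longleftrightarrow> (case l of None \<Rightarrow> True | Some b \<Rightarrow> b < c)) \<and>
        (a - c \<in> W \<longleftrightarrow> (case w of None \<Rightarrow> False | Some b \<Rightarrow> b - c \<in> W)))"

section \<open>Roots of atomic formulas and substitution of virtual points\<close>

primrec coef :: "nat \<Rightarrow> 'k::field trm \<Rightarrow> 'k" where
  "coef x (Var i) = (if i = x then 1 else 0)"
| "coef x Zero = 0"
| "coef x One = 0"
| "coef x (Add s t) = coef x s + coef x t"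
| "coef x (Minus t) = - coef x t"
| "coef x (Scal c t) = c * coef x t"

abbreviation drop_var :: "nat \<Rightarrow> 'k trm \<Rightarrow> 'k trm" where
  "drop_var x \<equiv> tsub (Var(x := Zero))"

text \<open>If \<open>coef x t = 0\<close>, this is a junk term with value \<open>0\<close>; additional roots do no harm.\<close>

definition root :: "nat \<Rightarrow> 'k::field trm \<Rightarrow> 'k trm" where
  "root x t = Scal (- inverse (coef x t)) (drop_var x t)"

primrec roots :: "nat \<Rightarrow> 'k::field fm \<Rightarrow> 'k trm set" where
  "roots x (Eq s t) = {root x (Add t (Minus s))}"
| "roots x (Less s t) = {root x (Add t (Minus s))}"
| "roots x (InU t) = {root x t}"
| "roots x (Neg \<phi>) = roots x \<phi>"
| "roots x (And \<phi> \<psi>) = roots x \<phi> \<union> roots x \<psi>"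
| "roots x (Ex i \<phi>) = {}"

text \<open>Together with \<open>in_coset\<close>, this expresses the case distinctions of
  \<open>at_point\<close> by formulas. The sentences \<open>0 = 0\<close> and \<open>0 < 0\<close>
  stand for true and false: every root lies to the right of a point far to the left, and no root
  lies in a new coset.\<close>

definition below_cut :: "'k trm option \<Rightarrow> 'k trm \<Rightarrow> 'k fm" where
  "below_cut l r = (case l of None \<Rightarrow> Eq Zero Zero | Some s \<Rightarrow> Less s r)"

definition in_coset :: "'k trm option \<Rightarrow> 'k trm \<Rightarrow> 'k fm" where
  "in_coset w r = (case w of None \<Rightarrow> Less Zero Zero | Some s \<Rightarrow> InU (Add s (Minus r)))"

text \<open>If the coefficient of \<open>x\<close> is 0, the variable drops out. Otherwise an
  equation fails because the point avoids all roots, and the sign of the coefficient in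
  \<open>t - s\<close> decides on which side of the root \<open>s < t\<close> holds.\<close>

primrec cut_sub ::
    "nat \<Rightarrow> 'k trm option \<Rightarrow> 'k trm option \<Rightarrow> 'k::linordered_field fm \<Rightarrow> 'k fm" where
  "cut_sub x l w (Eq s t) =
     (let u = Add t (Minus s) in
      if coef x u = 0 then Eq (drop_var x u) Zero else Less Zero Zero)"
| "cut_sub x l w (Less s t) =
     (let u = Add t (Minus s) in
      if coef x u = 0 then Less Zero (drop_var x u)
      else if coef x u < 0 then below_cut l (root x u)
      else Neg (below_cut l (root x u)))"
| "cut_sub x l w (InU t) =
     (if coef x t = 0 then InU (drop_var x t) else in_coset w (root x t))"
| "cut_sub x l w (Neg \<phi>) = Neg (cut_sub x l w \<phi>)"
| "cut_sub x l w (And \<phi> \<psi>) = And (cut_sub x l w \<phi>) (cut_sub x l w \<psi>)"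
| "cut_sub x l w (Ex i \<phi>) = Ex i \<phi>"

primrec point_sub ::
    "nat \<Rightarrow> ('k trm, 'k trm) point \<Rightarrow> 'k::linordered_field fm \<Rightarrow> 'k fm" where
  "point_sub x (Exact r) = fsub (Var(x := r))"
| "point_sub x (Cut l w) = cut_sub x l w"

lemma finite_roots: "finite (roots x \<phi>)"
  by (induction \<phi>) auto

lemma trm_vars_drop_var: "trm_vars (drop_var x t) = trm_vars t - {x}"
  by (auto simp: trm_vars_tsub split: if_splits)

lemma trm_vars_root: "trm_vars (root x t) = trm_vars t - {x}"
  by (simp add: root_def trm_vars_drop_var)

lemma trm_vars_roots: "r \<in> roots x \<phi> \<Longrightarrow> trm_vars r \<subseteq> free_vars \<phi> - {x}"
  by (induction \<phi>) (auto simp: trm_vars_root)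

lemma qf_cut_sub: "qf \<phi> \<Longrightarrow> qf (cut_sub x l w \<phi>)"
  by (induction \<phi>) (auto simp: Let_def below_cut_def in_coset_def split: option.splits)

lemma qf_point_sub: "qf \<phi> \<Longrightarrow> qf (point_sub x p \<phi>)"
  by (cases p) (auto simp: qf_fsub qf_cut_sub)

lemma free_vars_cut_sub:
  assumes "qf \<phi>" "\<And>r. r \<in> set_option l \<union> set_option w \<Longrightarrow> trm_vars r \<subseteq> A"
  shows "free_vars (cut_sub x l w \<phi>) \<subseteq> free_vars \<phi> - {x} \<union> A"
proof -
  have "free_vars (below_cut l r) \<subseteq> trm_vars r \<union> A" "free_vars (in_coset w r) \<subseteq> trm_vars r \<union> A" for r
    using assms(2) by (auto simp: below_cut_def in_coset_def split: option.splits)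
  note cut = this[of "root x _", unfolded trm_vars_root]
  show ?thesis
    using assms(1)
  proof (induction \<phi>)
    case (Eq s t)
    show ?case by (auto simp: Let_def trm_vars_drop_var)
  next
    case (Less s t)
    show ?case using cut(1)[of "Add t (Minus s)"] by (auto simp: Let_def trm_vars_drop_var)
  next
    case (InU t)
    show ?case using cut(2)[of t] by (auto simp: trm_vars_drop_var)
  qed auto
qed

lemma free_vars_point_sub:
  assumes "qf \<phi>" "\<And>r. r \<in> set1_point p \<union> set2_point p \<Longrightarrow> trm_vars r \<subseteq> A"
  shows "free_vars (point_sub x p \<phi>) \<subseteq> free_vars \<phi> - {x} \<union> A"
proof (cases p)
  case (Exact r)
  then show ?thesis
    using assms by (auto simp: free_vars_fsub split: if_splits)
next
  case (Cut l w)
  then show ?thesis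
    using assms free_vars_cut_sub[of \<phi> l w A x] by auto
qed

lemma set_point_points: "p \<in> points A \<Longrightarrow> set1_point p \<union> set2_point p \<subseteq> A"
  by (auto simp: points_def options_def)


section \<open>Quantifier elimination for dense pairs\<close>

locale dense_pair_structure =
  fixes M :: "('k::linordered_field, 'v::linordered_ab_group_add) pair_structure"
  assumes dense_pair: "dense_pair M"
begin

abbreviation scale where "scale \<equiv> scal_op M"
abbreviation W where "W \<equiv> subsp M"

sublocale vector_space scale
  using dense_pair by (simp add: dense_pair_def ordered_vs_def)

lemma subspace_W: "subspace W"
  and dense_W: "a < b \<Longrightarrow> \<exists>w\<in>W. a < w \<and> w < b"
  and scale_pos: "0 < c \<Longrightarrow> 0 < v \<Longrightarrow> 0 < scale c v"
  and dist_one_pos: "0 < dist_one M"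
  using dense_pair by (auto simp: dense_pair_def ordered_vs_def)

lemma diff_mem_W_iff: "a - b \<in> W \<Longrightarrow> a - c \<in> W \<longleftrightarrow> b - c \<in> W"
  using subspace_add[OF subspace_W, of "a - b" "b - c"] subspace_diff[OF subspace_W, of "a - c" "a - b"]
  by auto

lemma scale_mem_W_iff: "c \<noteq> 0 \<Longrightarrow> scale c v \<in> W \<longleftrightarrow> v \<in> W"
  using subspace_scale[OF subspace_W, of v c] subspace_scale[OF subspace_W, of "scale c v" "inverse c"]
  by auto

lemma scale_pos_iff:
  assumes "0 < c"
  shows "0 < scale c v \<longleftrightarrow> 0 < v"
  using scale_pos[OF assms, of v] scale_pos[of "inverse c" "scale c v"] assms by auto

lemma scale_pos_iff_neg: "c < 0 \<Longrightarrow> 0 < scale c v \<longleftrightarrow> v < 0"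
  using scale_pos_iff[of "- c" "- v"] by simp

lemma trm_val_split: "trm_val M e t = scale (coef x t) (e x) + trm_val M e (drop_var x t)"
  by (induction t) (auto simp: algebra_simps)

text \<open>This factorization turns positivity of a term, or its membership in \<open>W\<close>,
  into a condition on the difference between \<open>x\<close> and the root.\<close>

lemma trm_val_root:
  assumes "coef x t \<noteq> 0"
  shows "trm_val M e t = scale (coef x t) (e x - trm_val M e (root x t))"
  using assms trm_val_split[of e t x] by (simp add: root_def scale_right_distrib)

section \<open>Realization of virtual points\<close>

text \<open>For \<open>v\<close> outside \<open>W\<close>, distinct multiples of \<open>v\<close>
  lie in distinct cosets of \<open>W\<close>. An ordered field is infinite, so some multiple avoids
  the finitely many cosets of elements of \<open>C\<close>.\<close>

lemma exists_new_coset: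
  assumes "finite C"
  shows "\<exists>d. \<forall>c\<in>C. d - c \<notin> W"
proof -
  obtain v where "v \<notin> W"
    using dense_pair by (auto simp: dense_pair_def)
  have "k = k'" if "scale k v - c \<in> W" "scale k' v - c \<in> W" for k k' c
  proof -
    have "scale (k - k') v \<in> W"
      using subspace_diff[OF subspace_W that] by (simp add: scale_left_diff_distrib)
    then show ?thesis
      using scale_mem_W_iff[of "k - k'" v] \<open>v \<notin> W\<close> by auto
  qed
  \<comment> \<open>At most one scalar belongs to this set, so it is contained in a
    singleton.\<close>
  then have "finite {k. scale k v - c \<in> W}" for c
    by (intro finite_subset[of "{k. scale k v - c \<in> W}" "{SOME k. scale k v - c \<in> W}"])
      (auto intro: someI2)
  then have "finite (\<Union>c\<in>C. {k. scale k v - c \<in> W})"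
    using assms by blast
  then obtain k where "k \<notin> (\<Union>c\<in>C. {k. scale k v - c \<in> W})"
    using ex_new_if_finite[OF infinite_UNIV_char_0] by blast
  then show ?thesis by blast
qed

text \<open>The position relative to \<open>C\<close> is constant on an open interval to the left of
  all of \<open>C\<close>, or from \<open>b\<close> to the next element of \<open>C\<close>.\<close>

lemma exists_gap:
  fixes C :: "'v set"
  assumes "finite C"
  shows "\<exists>lo hi. lo < hi \<and>
    (\<forall>a c. lo < a \<longrightarrow> a < hi \<longrightarrow> c \<in> C \<longrightarrow>
       a \<noteq> c \<and> (a < c \<longleftrightarrow> (case l of None \<Rightarrow> True | Some b \<Rightarrow> b < c)))"
proof (cases l)
  case None
  \<comment> \<open>Inserting 0 makes the minimum meaningful for empty \<open>C\<close>.\<close>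
  define hi where "hi = Min (insert 0 C)"
  have "hi \<le> c" if "c \<in> C" for c
    using that assms by (simp add: hi_def)
  then show ?thesis
    using None dist_one_pos by (intro exI[of _ "hi - dist_one M"] exI[of _ hi]) fastforce
next
  case (Some b)
  \<comment> \<open>The bound \<open>b + 1\<close> closes the interval when no element of
    \<open>C\<close> exceeds \<open>b\<close>.\<close>
  define hi where "hi = Min (insert (b + dist_one M) {c \<in> C. b < c})"
  have "b < hi"
    using assms dist_one_pos by (auto simp: hi_def)
  moreover have "hi \<le> c" if "c \<in> C" "b < c" for c
    using that assms by (auto simp: hi_def)
  ultimately show ?thesis
    using Some by (intro exI[of _ b] exI[of _ hi]) fastforce
qed

text \<open>Density of \<open>W\<close> makes each of its cosets dense, so cut and coset can be
  prescribed independently. The entries of \<open>p\<close> need not belong to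
  \<open>C\<close>.\<close>

lemma at_point_realized:
  assumes "finite C"
  shows "\<exists>a. at_point W C a p"
proof (cases p)
  case (Cut l w)
  obtain d where d: "\<forall>c\<in>C. d - c \<in> W \<longleftrightarrow> (case w of None \<Rightarrow> False | Some b \<Rightarrow> b - c \<in> W)"
  proof (cases w)
    case None
    then show ?thesis using exists_new_coset[OF assms] that by auto
  next
    case (Some b)
    then show ?thesis using that[of b] by auto
  qed
  obtain lo hi where gap: "lo < hi"
    "\<forall>a c. lo < a \<longrightarrow> a < hi \<longrightarrow> c \<in> C \<longrightarrow>
       a \<noteq> c \<and> (a < c \<longleftrightarrow> (case l of None \<Rightarrow> True | Some b \<Rightarrow> b < c))"
    using exists_gap[OF assms, of l] by blast
  \<comment> \<open>The coset of \<open>d\<close> meets the gap because \<open>W\<close> meets the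
    gap translated by \<open>-d\<close>.\<close>
  obtain v where v: "v \<in> W" "lo - d < v" "v < hi - d"
    using dense_W[of "lo - d" "hi - d"] gap(1) by auto
  have "v + d - c \<in> W \<longleftrightarrow> d - c \<in> W" for c
    using diff_mem_W_iff[of "v + d" d c] v(1) by simp
  moreover have "lo < v + d" "v + d < hi"
    using v by (simp_all add: algebra_simps)
  ultimately have "at_point W C (v + d) p"
    using d gap(2) Cut by simp
  then show ?thesis ..
qed simp

text \<open>Outside \<open>C\<close>, the cut entry is the largest element of \<open>C\<close> below
  \<open>a\<close>, and the coset entry is any element of \<open>C\<close> congruent to
  \<open>a\<close> modulo \<open>W\<close>. Congruence is transitive, so the choice does not
  matter.\<close>

lemma at_point_exists:
  assumes "finite C"
  shows "\<exists>p\<in>points C. at_point W C a p"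
proof (cases "a \<in> C")
  case True
  then show ?thesis by (intro bexI[of _ "Exact a"]) (auto simp: points_def)
next
  case False
  define L where "L = {c \<in> C. c < a}"
  have "finite L" using assms by (simp add: L_def)
  define l where "l = (if L = {} then None else Some (Max L))"
  have "l \<in> options C"
    using Max_in[OF \<open>finite L\<close>] by (auto simp: l_def L_def options_def)
  have l: "a < c \<longleftrightarrow> (case l of None \<Rightarrow> True | Some b \<Rightarrow> b < c)" if "c \<in> C" for c
  proof -
    have "c \<in> L \<longleftrightarrow> \<not> a < c"
      using that False by (auto simp: L_def not_less order.order_iff_strict)
    moreover have "c \<notin> L \<longleftrightarrow> Max L < c" if "L \<noteq> {}"
    proof
      assume "c \<notin> L"
      then have "a < c" using \<open>c \<in> C\<close> \<open>c \<in> L \<longleftrightarrow> \<not> a < c\<close> by simp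
      then show "Max L < c" using Max_in[OF \<open>finite L\<close> that] by (auto simp: L_def)
    next
      assume "Max L < c"
      then show "c \<notin> L" using Max_ge[OF \<open>finite L\<close>, of c] by auto
    qed
    ultimately show ?thesis by (auto simp: l_def)
  qed
  obtain w where "w \<in> options C"
    and w: "\<forall>c\<in>C. a - c \<in> W \<longleftrightarrow> (case w of None \<Rightarrow> False | Some b \<Rightarrow> b - c \<in> W)"
  proof (cases "\<exists>b\<in>C. a - b \<in> W")
    case True
    then obtain b where "b \<in> C" "a - b \<in> W" by blast
    then show ?thesis using that[of "Some b"] diff_mem_W_iff[of a b] by (auto simp: options_def)
  next
    case False
    then show ?thesis using that[of None] by (auto simp: options_def)
  qed
  have "Cut l w \<in> points C"
    using \<open>l \<in> _\<close> \<open>w \<in> _\<close> by (auto simp: points_def)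
  moreover have "at_point W C a (Cut l w)"
    using l w False by auto
  ultimately show ?thesis by blast
qed

section \<open>Truth under substitution and elimination of a quantifier\<close>

text \<open>Each atomic formula either does not depend on the value of \<open>x\<close> or compares
  \<open>a\<close> with a root. The values of the roots lie in \<open>C\<close>, so
  \<open>at_point\<close> settles the comparison.\<close>

lemma sat_cut_sub:
  assumes "qf \<phi>" "trm_val M e ` roots x \<phi> \<subseteq> C"
    and "at_point W C a (Cut (map_option (trm_val M e) l) (map_option (trm_val M e) w))"
  shows "sat M e (cut_sub x l w \<phi>) \<longleftrightarrow> sat M (e(x := a)) \<phi>"
proof -
  define e' where "e' = e(x := a)"
  have indep: "trm_val M e' t = trm_val M e t" if "x \<notin> trm_vars t" for t :: "'k trm"
    using that by (intro trm_val_cong) (auto simp: e'_def)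
  have val0: "trm_val M e' u = trm_val M e (drop_var x u)" if "coef x u = 0" for u
    using that trm_val_split[of e' u x] indep[of "drop_var x u"] by (simp add: trm_vars_drop_var)
  have val: "trm_val M e' u = scale (coef x u) (a - trm_val M e (root x u))" if "coef x u \<noteq> 0" for u
    using trm_val_root[OF that, of e'] indep[of "root x u"] by (simp add: trm_vars_root e'_def)
  have cut: "a < trm_val M e r \<longleftrightarrow> sat M e (below_cut l r)"
    and coset: "a - trm_val M e r \<in> W \<longleftrightarrow> sat M e (in_coset w r)"
    and neq: "a \<noteq> trm_val M e r"
    if "trm_val M e r \<in> C" for r
    using assms(3) that by (auto simp: below_cut_def in_coset_def split: option.splits)
  have "sat M e (cut_sub x l w \<phi>) \<longleftrightarrow> sat M e' \<phi>"
    using assms(1,2)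
  proof (induction \<phi>)
    case (Eq s t)
    define u where "u = Add t (Minus s)"
    have "sat M e' (Eq s t) \<longleftrightarrow> trm_val M e' u = 0"
      by (auto simp: u_def)
    moreover have "a \<noteq> trm_val M e (root x u)"
      using Eq by (intro neq) (simp add: u_def)
    ultimately show ?case
      using val0[of u] val[of u] by (simp add: Let_def flip: u_def)
  next
    case (Less s t)
    define u where "u = Add t (Minus s)"
    have less: "sat M e' (Less s t) \<longleftrightarrow> 0 < trm_val M e' u"
      by (auto simp: u_def)
    have C: "trm_val M e (root x u) \<in> C"
      using Less by (simp add: u_def)
    have sub: "cut_sub x l w (Less s t) =
      (if coef x u = 0 then Less Zero (drop_var x u)
       else if coef x u < 0 then below_cut l (root x u) else Neg (below_cut l (root x u)))"
      by (simp only: cut_sub.simps Let_def u_def)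
    consider "coef x u = 0" | "coef x u < 0" | "coef x u > 0"
      by fastforce
    then have "0 < trm_val M e' u \<longleftrightarrow> sat M e (cut_sub x l w (Less s t))"
    proof cases
      case 1
      then show ?thesis unfolding sub by (simp add: val0)
    next
      case 2
      then have "0 < trm_val M e' u \<longleftrightarrow> a < trm_val M e (root x u)"
        by (simp add: val scale_pos_iff_neg)
      then show ?thesis unfolding sub using 2 cut[OF C] by simp
    next
      case 3
      \<comment> \<open>As \<open>a\<close> differs from the root, lying above it is the same as not
        lying below it.\<close>
      then have "0 < trm_val M e' u \<longleftrightarrow> \<not> a < trm_val M e (root x u)"
        using neq[OF C] by (simp add: val scale_pos_iff not_less order.order_iff_strict)
      then show ?thesis unfolding sub using 3 cut[OF C] by simp
    qed
    then show ?case using less by blast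
  next
    case (InU t)
    then show ?case
      using val0[of t] val[of t] coset[of "root x t"] by (simp add: scale_mem_W_iff)
  qed auto
  then show ?thesis by (simp add: e'_def)
qed

lemma sat_point_sub:
  assumes "qf \<phi>" "trm_val M e ` roots x \<phi> \<subseteq> C"
    and "at_point W C a (map_point (trm_val M e) (trm_val M e) p)"
  shows "sat M e (point_sub x p \<phi>) \<longleftrightarrow> sat M (e(x := a)) \<phi>"
proof (cases p)
  case (Exact r)
  have "(\<lambda>i. trm_val M e ((Var(x := r)) i)) = e(x := trm_val M e r)"
    by auto
  then show ?thesis
    using assms Exact by (simp add: sat_fsub)
next
  case (Cut l w)
  then show ?thesis
    using assms by (simp add: sat_cut_sub)
qed

text \<open>The eliminated formula is the disjunction of the substitutions over all virtual points
  of the roots. A true disjunct gives a witness because every point is realized; conversely, every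
  witness is at one of these points.\<close>

lemma quantifier_elimination_step:
  assumes "qf \<phi>"
  shows "\<exists>\<psi>. qf \<psi> \<and> free_vars \<psi> \<subseteq> free_vars \<phi> - {x} \<and> (\<forall>e. sat M e \<psi> \<longleftrightarrow> (\<exists>a. sat M (e(x := a)) \<phi>))"
proof -
  define S where "S = (\<lambda>p. point_sub x p \<phi>) ` points (roots x \<phi>)"
  have "finite S"
    by (simp add: S_def finite_points finite_roots)
  moreover have "\<forall>\<phi>\<in>S. qf \<phi>"
    using assms by (simp add: S_def qf_point_sub)
  ultimately obtain \<psi> where \<psi>: "qf \<psi>" "free_vars \<psi> = \<Union> (free_vars ` S)"
    "\<forall>e. sat M e \<psi> \<longleftrightarrow> (\<exists>\<phi>\<in>S. sat M e \<phi>)"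
    using finite_disjunction[of S M] by metis
  have "free_vars (point_sub x p \<phi>) \<subseteq> free_vars \<phi> - {x}" if "p \<in> points (roots x \<phi>)" for p
    using free_vars_point_sub[OF assms, of p "free_vars \<phi> - {x}" x]
      set_point_points[OF that] trm_vars_roots[of _ x \<phi>]
    by blast
  then have "free_vars \<psi> \<subseteq> free_vars \<phi> - {x}"
    unfolding \<psi>(2) S_def by blast
  moreover have "(\<exists>\<phi>\<in>S. sat M e \<phi>) \<longleftrightarrow> (\<exists>a. sat M (e(x := a)) \<phi>)" for e
  proof -
    \<comment> \<open>The values of the roots vary with \<open>e\<close>, but \<open>S\<close> is
      built from terms and does not. \<open>points_image\<close> lifts a point over the values to
      one over the terms.\<close>
    define C where "C = trm_val M e ` roots x \<phi>"
    have "finite C" by (simp add: C_def finite_roots)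
    have sub: "sat M e (point_sub x p \<phi>) \<longleftrightarrow> sat M (e(x := a)) \<phi>"
      if "at_point W C a (map_point (trm_val M e) (trm_val M e) p)" for a p
      using assms that by (intro sat_point_sub) (auto simp: C_def)
    show ?thesis
    proof
      assume "\<exists>\<phi>\<in>S. sat M e \<phi>"
      then obtain p where "sat M e (point_sub x p \<phi>)"
        by (auto simp: S_def)
      moreover obtain a where "at_point W C a (map_point (trm_val M e) (trm_val M e) p)"
        using at_point_realized[OF \<open>finite C\<close>] by blast
      ultimately show "\<exists>a. sat M (e(x := a)) \<phi>"
        using sub by blast
    next
      assume "\<exists>a. sat M (e(x := a)) \<phi>"
      then obtain a where a: "sat M (e(x := a)) \<phi>" ..
      obtain P where "P \<in> points C" "at_point W C a P"
        using at_point_exists[OF \<open>finite C\<close>] by blast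
      moreover from this(1) obtain p
        where "p \<in> points (roots x \<phi>)" "P = map_point (trm_val M e) (trm_val M e) p"
        unfolding C_def points_image by (rule imageE)
      ultimately have "point_sub x p \<phi> \<in> S" "sat M e (point_sub x p \<phi>)"
        using sub[of a p] a by (simp_all add: S_def)
      then show "\<exists>\<phi>\<in>S. sat M e \<phi>" ..
    qed
  qed
  ultimately show ?thesis using \<psi>(1,3) by metis
qed

lemma quantifier_elimination:
  "\<exists>\<psi>. qf \<psi> \<and> free_vars \<psi> \<subseteq> free_vars \<phi> \<and> (\<forall>e. sat M e \<psi> \<longleftrightarrow> sat M e \<phi>)"
proof (induction \<phi>)
  case (Neg \<phi>)
  then obtain \<psi> where "qf \<psi>" "free_vars \<psi> \<subseteq> free_vars \<phi>" "\<forall>e. sat M e \<psi> \<longleftrightarrow> sat M e \<phi>" by blast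
  then show ?case by (intro exI[of _ "Neg \<psi>"]) auto
next
  case (And \<phi>1 \<phi>2)
  then obtain \<psi>1 \<psi>2 where "qf \<psi>1" "free_vars \<psi>1 \<subseteq> free_vars \<phi>1" "\<forall>e. sat M e \<psi>1 \<longleftrightarrow> sat M e \<phi>1"
    "qf \<psi>2" "free_vars \<psi>2 \<subseteq> free_vars \<phi>2" "\<forall>e. sat M e \<psi>2 \<longleftrightarrow> sat M e \<phi>2" by blast
  then show ?case by (intro exI[of _ "And \<psi>1 \<psi>2"]) auto
next
  case (Ex i \<phi>)
  then obtain \<psi> where \<psi>: "qf \<psi>" "free_vars \<psi> \<subseteq> free_vars \<phi>" "\<forall>e. sat M e \<psi> \<longleftrightarrow> sat M e \<phi>" by blast
  obtain \<chi> where \<chi>: "qf \<chi>" "free_vars \<chi> \<subseteq> free_vars \<psi> - {i}"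
    "\<forall>e. sat M e \<chi> \<longleftrightarrow> (\<exists>a. sat M (e(i := a)) \<psi>)"
    using quantifier_elimination_step[OF \<psi>(1), of i] by metis
  then show ?case
    using \<psi>(2,3) by (intro exI[of _ \<chi>]) auto
next
  case (Eq s t)
  show ?case by (rule exI[of _ "Eq s t"]) simp
next
  case (Less s t)
  show ?case by (rule exI[of _ "Less s t"]) simp
next
  case (InU t)
  show ?case by (rule exI[of _ "InU t"]) simp
qed


section \<open>Definability of types\<close>

text \<open>The object variable \<open>0\<close> receives a dummy value.\<close>

definition param_val :: "'v list \<Rightarrow> 'k trm \<Rightarrow> 'v" where
  "param_val b = trm_val M ((!) (0 # b))"

text \<open>
  The entries of the point are moved to the blocks of \<open>y\<^sub>1\<close> and \<open>y\<^sub>2\<close>, whose variables still have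
  the offset \<open>1\<close> caused by the object variable; it is removed at the end.
\<close>

definition type_def_fm :: "nat \<Rightarrow> ('k trm, 'k trm) point \<Rightarrow> 'k fm \<Rightarrow> 'k fm" where
  "type_def_fm n q \<psi> =
     fsub (\<lambda>k. Var (k - 1))
       (point_sub 0
         (map_point (tsub (\<lambda>k. Var (n + k))) (tsub (\<lambda>k. Var (2 * n + k))) q) \<psi>)"

text \<open>Before the offset is removed, the three blocks occupy the variables \<open>1..n\<close>,
  \<open>n+1..2n\<close> and \<open>2n+1..3n\<close>, the last two being reached by shifting the
  variables of the roots by \<open>n\<close> and \<open>2n\<close>.\<close>

lemma free_vars_type_def_fm:
  assumes "qf \<psi>" "free_vars \<psi> \<subseteq> {..<1 + n}" "q \<in> points R"
    and R: "\<And>r. r \<in> R \<Longrightarrow> trm_vars r \<subseteq> {1..n}"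
  shows "free_vars (type_def_fm n q \<psi>) \<subseteq> {..<n + 2 * n}"
proof -
  let ?q = "map_point (tsub (\<lambda>k. Var (n + k))) (tsub (\<lambda>k. Var (2 * n + k))) q"
  have "trm_vars r \<subseteq> {1..n + 2 * n}" if r: "r \<in> set1_point ?q \<union> set2_point ?q" for r
  proof -
    obtain s where "s \<in> R" "r = tsub (\<lambda>k. Var (n + k)) s \<or> r = tsub (\<lambda>k. Var (2 * n + k)) s"
      using r set_point_points[OF assms(3)] by (auto simp: point.set_map)
    then show ?thesis using R[of s] by (fastforce simp: trm_vars_tsub)
  qed
  then have "free_vars (point_sub 0 ?q \<psi>) \<subseteq> free_vars \<psi> - {0} \<union> {1..n + 2 * n}"
    by (intro free_vars_point_sub assms(1))
  also have "\<dots> \<subseteq> {1..n + 2 * n}"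
    using assms(2) by fastforce
  finally show ?thesis
    using assms(1) by (fastforce simp: type_def_fm_def free_vars_fsub qf_point_sub)
qed

text \<open>The entries of the point are evaluated at \<open>b1\<close> and \<open>b2\<close>, the
  roots of \<open>\<psi>\<close> at \<open>b\<close>. The latter values lie in \<open>C\<close>, so
  the point fixed by \<open>b1\<close> and \<open>b2\<close> decides \<open>\<psi>\<close> at every
  such \<open>b\<close>.\<close>

lemma sat_type_def_fm:
  assumes "qf \<psi>" "free_vars \<psi> \<subseteq> {..<1 + n}" "q \<in> points R"
    and R: "\<And>r. r \<in> R \<Longrightarrow> trm_vars r \<subseteq> {1..n}"
    and "roots 0 \<psi> \<subseteq> R" "param_val b ` R \<subseteq> C"
    and len: "length b = n" "length b1 = n" "length b2 = n"
    and at: "at_point W C a (map_point (param_val b1) (param_val b2) q)"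
  shows "sat M ((!) (b @ b1 @ b2)) (type_def_fm n q \<psi>) \<longleftrightarrow> sat M ((!) (a # b)) \<psi>"
proof -
  let ?f = "tsub (\<lambda>k. Var (n + k))" and ?g = "tsub (\<lambda>k. Var (2 * n + k))"
  \<comment> \<open>This undoes the offset. Truncated subtraction gives variable 0 the value of
    variable 1; no term in \<open>R\<close> contains variable 0, and it is finally reassigned to
    \<open>a\<close>.\<close>
  define e where "e = (\<lambda>k. (b @ b1 @ b2) ! (k - 1))"
  have val: "trm_val M e r = param_val b r" "trm_val M e (?f r) = param_val b1 r"
    "trm_val M e (?g r) = param_val b2 r" if "r \<in> R" for r
    unfolding param_val_def trm_val_tsub using R[OF that] len
    by (auto intro!: trm_val_cong simp: e_def nth_append nth_Cons split: nat.splits dest!: subsetD)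
  have "map_point (trm_val M e) (trm_val M e) (map_point ?f ?g q)
      = map_point (param_val b1) (param_val b2) q"
    unfolding point.map_comp
    using set_point_points[OF assms(3)] by (intro point.map_cong0) (auto simp: val)
  then have at': "at_point W C a (map_point (trm_val M e) (trm_val M e) (map_point ?f ?g q))"
    using at by simp
  have roots: "trm_val M e ` roots 0 \<psi> \<subseteq> C"
    using assms(5,6) val(1) by fastforce
  have "sat M ((!) (b @ b1 @ b2)) (type_def_fm n q \<psi>) \<longleftrightarrow> sat M e (point_sub 0 (map_point ?f ?g q) \<psi>)"
    using assms(1) by (simp add: type_def_fm_def sat_fsub qf_point_sub e_def)
  also have "\<dots> \<longleftrightarrow> sat M (e(0 := a)) \<psi>"
    by (rule sat_point_sub[OF assms(1) roots at'])
  also have "\<dots> \<longleftrightarrow> sat M ((!) (a # b)) \<psi>"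
    using assms(2) len(1)
    by (intro sat_cong) (auto simp: e_def nth_append nth_Cons split: nat.splits dest!: subsetD)
  finally show ?thesis .
qed

end

section \<open>Realization of types and the two defining parameters\<close>

text \<open>Over finite \<open>B\<close> the type is itself finite, so consistency yields a single
  realization. By maximality the type contains every positive instance true there.\<close>

lemma delta_type_realized:
  assumes "finite \<Delta>" "finite B" "p \<in> delta_types M m \<Delta> B"
  shows "\<exists>a. length a = m \<and> (\<forall>\<phi>\<in>\<Delta>. \<forall>b\<in>B. PosInst \<phi> b \<in> p \<longleftrightarrow> sat M ((!) (a @ b)) \<phi>)"
proof -
  have p: "p \<subseteq> instances \<Delta> B" "consistent M m p"
    and maximal: "\<And>q. p \<subseteq> q \<Longrightarrow> q \<subseteq> instances \<Delta> B \<Longrightarrow> consistent M m q \<Longrightarrow> q = p"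
    using assms(3) by (auto simp: delta_types_def)
  have "instances \<Delta> B = case_prod PosInst ` (\<Delta> \<times> B) \<union> case_prod NegInst ` (\<Delta> \<times> B)"
    by (auto simp: instances_def)
  then have "finite p"
    using assms(1,2) p(1) by (auto intro: finite_subset)
  then obtain a where a: "length a = m" "\<forall>f\<in>p. realizes M a f"
    using p(2) unfolding consistent_def by blast
  have "PosInst \<phi> b \<in> p" if "\<phi> \<in> \<Delta>" "b \<in> B" "sat M ((!) (a @ b)) \<phi>" for \<phi> b
  proof -
    \<comment> \<open>The same \<open>a\<close> realizes the enlarged set, hence each of its finite
      subsets.\<close>
    have "consistent M m (insert (PosInst \<phi> b) p)"
      unfolding consistent_def using a that(3)
      by (metis insert_iff realizes.simps(1) subset_iff)
    then have "insert (PosInst \<phi> b) p = p"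
      using p(1) that by (intro maximal) (auto simp: instances_def)
    then show ?thesis by blast
  qed
  then show ?thesis
    using a by fastforce
qed

theorem theorem1p2:
  fixes M :: "('k::linordered_field, 'v::linordered_ab_group_add) pair_structure"
  assumes "dense_pair M"
  shows "vc_property M 2"
  unfolding vc_property_def
proof (intro allI impI)
  fix n and \<Delta> :: "'k fm set"
  assume "finite \<Delta>" and \<Delta>: "\<forall>\<phi>\<in>\<Delta>. partitioned 1 n \<phi>"
  interpret dense_pair_structure M
    using assms by unfold_locales
  obtain qe where qe: "\<And>\<phi>. qf (qe \<phi>)" "\<And>\<phi>. free_vars (qe \<phi>) \<subseteq> free_vars \<phi>"
    "\<And>\<phi> e. sat M e (qe \<phi>) \<longleftrightarrow> sat M e \<phi>"
    using quantifier_elimination by metis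
  have vars: "free_vars (qe \<phi>) \<subseteq> {..<1 + n}" if "\<phi> \<in> \<Delta>" for \<phi>
    using \<Delta> that qe(2)[of \<phi>] by (auto simp: partitioned_def)
  \<comment> \<open>One finite set of roots serves all of \<open>\<Delta>\<close> and is independent
    of \<open>B\<close>. Its virtual points, enumerated by \<open>h\<close>, index the defining
    families.\<close>
  define R where "R = (\<Union>\<phi>\<in>\<Delta>. roots 0 (qe \<phi>))"
  have "finite R"
    using \<open>finite \<Delta>\<close> by (simp add: R_def finite_roots)
  have R: "trm_vars r \<subseteq> {1..n}" if "r \<in> R" for r
    using that vars trm_vars_roots by (fastforce simp: R_def)
  obtain h where h: "bij_betw h {0..<card (points R)} (points R)"
    using ex_bij_betw_nat_finite[OF finite_points[OF \<open>finite R\<close>]] by blast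
  show "udtfs M 2 1 n \<Delta>"
    unfolding udtfs_def
  proof (rule exI[of _ "card (points R)"], rule exI[of _ "\<lambda>i \<phi>. type_def_fm n (h i) (qe \<phi>)"],
      intro conjI allI ballI impI)
    fix i \<phi> assume "i < card (points R)" "\<phi> \<in> \<Delta>"
    then have "h i \<in> points R"
      using h by (auto simp: bij_betw_def)
    then show "free_vars (type_def_fm n (h i) (qe \<phi>)) \<subseteq> {..<n + 2 * n}"
      using free_vars_type_def_fm[OF qe(1) vars[OF \<open>\<phi> \<in> \<Delta>\<close>]] R by blast
  next
    fix B :: "'v list set" and p
    assume "finite B" "B \<noteq> {}" and B: "B \<subseteq> {b. length b = n}" and "p \<in> delta_types M 1 \<Delta> B"
    then obtain a' where "length a' = 1"
      and a': "\<forall>\<phi>\<in>\<Delta>. \<forall>b\<in>B. PosInst \<phi> b \<in> p \<longleftrightarrow> sat M ((!) (a' @ b)) \<phi>"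
      using delta_type_realized[OF \<open>finite \<Delta>\<close>] by blast
    then obtain a where "a' = [a]"
      by (auto simp: length_Suc_conv)
    with a' have a: "\<forall>\<phi>\<in>\<Delta>. \<forall>b\<in>B. PosInst \<phi> b \<in> p \<longleftrightarrow> sat M ((!) (a # b)) \<phi>"
      by simp
    \<comment> \<open>All roots at all tuples of \<open>B\<close> are collected, so that one virtual
      point describes \<open>a\<close> for every instance at once.\<close>
    define C where "C = (\<lambda>(r, b). param_val b r) ` (R \<times> B)"
    have "finite C"
      using \<open>finite R\<close> \<open>finite B\<close> by (simp add: C_def)
    then obtain P where "P \<in> points C" "at_point W C a P"
      using at_point_exists by blast
    \<comment> \<open>The point splits into two tuples of \<open>B\<close> and a point
      \<open>q\<close> over root terms: the tuples are the parameters, and \<open>q\<close> selects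
      the family.\<close>
    then obtain b1 b2 q where b12: "b1 \<in> B" "b2 \<in> B" and q: "q \<in> points R"
      and at: "at_point W C a (map_point (param_val b1) (param_val b2) q)"
      using points_family[of P param_val R B] \<open>B \<noteq> {}\<close> unfolding C_def by blast
    have "q \<in> h ` {0..<card (points R)}"
      using h q by (simp add: bij_betw_def)
    then obtain i where i: "i < card (points R)" "h i = q"
      by auto
    have "PosInst \<phi> b \<in> p \<longleftrightarrow> sat M ((!) (b @ b1 @ b2)) (type_def_fm n q (qe \<phi>))"
      if "b \<in> B" "\<phi> \<in> \<Delta>" for b \<phi>
    proof -
      have "roots 0 (qe \<phi>) \<subseteq> R" "param_val b ` R \<subseteq> C"
        using that by (auto simp: R_def C_def)
      then show ?thesis
        using sat_type_def_fm[OF qe(1) vars[OF that(2)] q R _ _ _ _ _ at, of b] B b12 that a qe(3)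
        by auto
    qed
    then show "\<exists>i<card (points R). \<exists>bs. length bs = 2 \<and> set bs \<subseteq> B \<and>
        (\<forall>b\<in>B. \<forall>\<phi>\<in>\<Delta>. PosInst \<phi> b \<in> p \<longleftrightarrow>
           sat M ((!) (b @ concat bs)) (type_def_fm n (h i) (qe \<phi>)))"
      using i b12 by (intro exI[of _ i] conjI exI[of _ "[b1, b2]"]) auto
  qed
qed

end
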